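(* Let $(a_n)_{n\ge0}$ be the sequence, listed in increasing order, of the non-negative integers $m$ such that $15m+1$ is a perfect square. Then $$\sum_{n=0}^\infty(-1)^{\lfloor (n+2)/4\rfloor}q^{a_n}=\frac{(q^2,q^6,q^8;q^8)_\infty\,(q^4,q^{12};q^{16})_\infty}{(q,q^4;q^5)_\infty}.$$
   Context: Here $q$ is a complex number with $|q|<1$ (equivalently, the identity may be read as an identity of formal power series in $q$). For a complex number $a$, $(a;q)_\infty:=\prod_{i=0}^\infty(1-aq^i)$, and $(a_1,a_2,\dots,a_m;q)_\infty:=\prod_{j=1}^m(a_j;q)_\infty$. $\lfloor x\rfloor$ is the floor function. *)

theory Defs
  imports "HOL-Analysis.Infinite_Products" "HOL-Library.Infinite_Set"
begin

definition qpoch_inf :: "complex \<Rightarrow> complex \<Rightarrow> complex" where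
  "qpoch_inf a q = (\<Prod>i. 1 - a * q ^ i)"

definition qpochs_inf :: "complex list \<Rightarrow> complex \<Rightarrow> complex" where
  "qpochs_inf as q = (\<Prod>a\<leftarrow>as. qpoch_inf a q)"

definition square_index_set :: "nat set" where
  "square_index_set = {m. \<exists>k. 15 * m + 1 = k ^ 2}"

text \<open>Infinitude makes \<^const>\<open>enumerate\<close> list this set in strictly increasing order.\<close>

lemma infinite_square_index_set: "infinite square_index_set"
proof -
  have "15 * j ^ 2 + 2 * j \<in> square_index_set" for j :: nat
  proof -
    have "15 * (15 * j ^ 2 + 2 * j) + 1 = (15 * j + 1) ^ 2"
      by (simp add: power2_eq_square algebra_simps)
    then show ?thesis
      unfolding square_index_set_def by blast
  qed
  moreover have "j \<le> 15 * j ^ 2 + 2 * j" for j :: nat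
    by simp
  ultimately show ?thesis
    unfolding infinite_nat_iff_unbounded_le by blast
qed

end

theory Submission
  imports Defs
begin

text \<open>
  The numerator collapses to \<open>(q\<^sup>2;q\<^sup>2)\<^sub>\<infinity>\<close>, so with \<open>p = q\<^bsup>10\<^esup>\<close> and \<open>z = q\<close> the right-hand side is
  \<open>(p, z\<^sup>2, p/z\<^sup>2; p)\<^sub>\<infinity> / (z, p/z; p)\<^sub>\<infinity>\<close>. By the quintuple product identity this is
  \<open>\<Sum>\<^sub>j (-1)\<^bsup>j\<^esup> (q\<^bsup>15j\<^sup>2-2j\<^esup> + q\<^bsup>15j\<^sup>2+8j+1\<^esup>)\<close>, and the exponents are the \<open>m\<close> with \<open>15m + 1 = (15j \<plusminus> 1)\<^sup>2\<close> or
  \<open>(15j \<plusminus> 4)\<^sup>2\<close>.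

  The quintuple product identity is the limit of a finite identity of Chen, Chu and Gu, which follows
  by telescoping: one writes \<open>x = z p\<^bsup>-n\<^esup>\<close>, \<open>m = 2n\<close>, \<open>k = n + j\<close> and applies Tannery's theorem as
  \<open>n \<rightarrow> \<infinity>\<close>.
\<close>

section \<open>Finite q-Pochhammer symbols\<close>

definition qpoch :: "'a::field \<Rightarrow> 'a \<Rightarrow> nat \<Rightarrow> 'a" where
  "qpoch a p n = (\<Prod>i<n. 1 - a * p ^ i)"

lemma qpoch_0 [simp]: "qpoch a p 0 = 1"
  by (simp add: qpoch_def)

lemma qpoch_Suc: "qpoch a p (Suc n) = qpoch a p n * (1 - a * p ^ n)"
  by (simp add: qpoch_def)

lemma qpoch_Suc_left: "qpoch a p (Suc n) = (1 - a) * qpoch (p * a) p n"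
  by (simp add: qpoch_def prod.lessThan_Suc_shift mult_ac del: prod.lessThan_Suc)

lemma qpoch_add: "qpoch a p (m + n) = qpoch a p m * qpoch (a * p ^ m) p n"
  by (induction n) (simp_all add: qpoch_Suc power_add mult_ac)

text \<open>The factors are \<open>1 - a / p ^ l\<close> for l = 1, ..., n, and each equals
  \<open>(- a / p ^ l) * (1 - p ^ l / a)\<close>. This trades the negative powers of
  \<open>p\<close> for an explicit monomial and a product that converges as n grows when
  \<open>norm p < 1\<close>.\<close>

lemma qpoch_reverse:
  assumes "p \<noteq> 0" "a \<noteq> 0"
  shows "qpoch (a / p ^ n) p n = (-a) ^ n / p ^ (n * (n + 1) div 2) * qpoch (p / a) p n"
proof (induction n)
  case (Suc n)
  have e: "Suc n * (Suc n + 1) div 2 = n * (n + 1) div 2 + Suc n"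
    by simp
  have "qpoch (a / p ^ Suc n) p (Suc n) = (1 - a / p ^ Suc n) * qpoch (a / p ^ n) p n"
    using assms by (simp add: qpoch_Suc_left)
  also have "1 - a / p ^ Suc n = (- a / p ^ Suc n) * (1 - p / a * p ^ n)"
    using assms by (simp add: field_simps)
  finally show ?case
    unfolding Suc e by (simp only: qpoch_Suc power_add power_Suc) (simp add: mult_ac)
qed simp

section \<open>The finite identity by telescoping\<close>

definition qbinom :: "'a::field \<Rightarrow> nat \<Rightarrow> nat \<Rightarrow> 'a" where
  "qbinom p m k = qpoch p p m / (qpoch p p k * qpoch p p (m - k))"

text \<open>The usual form of the finite identity also has \<open>qpoch x p (Suc m)\<close> in the
  summand. Kept outside the sum, it turns the step from \<open>m\<close> to \<open>Suc m\<close>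
  into multiplication by \<open>1 - x * p ^ Suc m\<close>.\<close>

definition quint_summand :: "'a::field \<Rightarrow> 'a \<Rightarrow> nat \<Rightarrow> nat \<Rightarrow> 'a" where
  "quint_summand x p m k =
     (1 + x * p ^ k) * qbinom p m k * x ^ k * p ^ k\<^sup>2 / qpoch (p ^ k * x\<^sup>2) p (Suc m)"

text \<open>
  With \<open>P = p\<^bsup>k\<^esup>\<close> and \<open>Q = p\<^bsup>m+1-k\<^esup>\<close>, this is the telescoping step of the next lemma after its common
  factor has been divided out.
\<close>

lemma quint_summand_certificate:
  fixes P Q x :: "'a::comm_ring_1"
  shows "(1 + x * P) * (1 - P * Q) * (1 - x * (P * Q)) =
      (1 + x * P) * (1 - Q) * (1 - P * (P * Q) * x\<^sup>2)
      - (1 - Q) * (x * P * (P * Q)) * (1 - P * x\<^sup>2) + (1 - P) * Q * (1 - P * (P * Q) * x\<^sup>2)"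
  by (simp add: algebra_simps power2_eq_square)

text \<open>A Wilf-Zeilberger pair: write F for the summand and G(k) for the fraction at the end,
  with k for \<open>K\<close>. Then \<open>1 - x * p ^ Suc m\<close> times F(m+1,k) is F(m,k) +
  G(k-1) - G(k), without G(k-1) at k = 0, so that only G(K) survives summation.\<close>

lemma quint_summand_telescope:
  fixes x p :: "'a::field"
  assumes nz: "\<And>i. 1 - x\<^sup>2 * p ^ i \<noteq> 0" and pnz: "\<And>i. p ^ Suc i \<noteq> 1" and "K \<le> m"
  shows "(1 - x * p ^ Suc m) * (\<Sum>k\<le>K. quint_summand x p (Suc m) k) =
      (\<Sum>k\<le>K. quint_summand x p m k)
      - qbinom p m K * x ^ Suc K * p ^ (Suc m + K\<^sup>2 + K) / qpoch (p ^ Suc K * x\<^sup>2) p (Suc m)"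
  using \<open>K \<le> m\<close>
proof (induction K)
  case 0
  have pp: "qpoch p p n \<noteq> 0" for n
    using pnz by (auto simp: qpoch_def)
  have D: "qpoch (p * x\<^sup>2) p m \<noteq> 0" 
    using nz[of "Suc _"] by (auto simp: qpoch_def mult_ac)
  have 1: "qpoch (x\<^sup>2) p (Suc m) = (1 - x\<^sup>2) * qpoch (p * x\<^sup>2) p m"
    by (simp add: qpoch_Suc_left)
  have 2: "qpoch (x\<^sup>2) p (Suc (Suc m)) = (1 - x\<^sup>2) * qpoch (p * x\<^sup>2) p m * (1 - x\<^sup>2 * p ^ Suc m)"
    by (simp add: qpoch_Suc_left[of _ _ "Suc m"]) (simp add: qpoch_Suc mult_ac)
  have 3: "qpoch (p * x\<^sup>2) p (Suc m) = qpoch (p * x\<^sup>2) p m * (1 - x\<^sup>2 * p ^ Suc m)"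
    by (simp add: qpoch_Suc mult_ac)
  show ?case
    using nz[of 0] nz[of "Suc m"] D pp
    by (simp add: quint_summand_def qbinom_def 1 2 3 divide_simps del: power_Suc)
       (simp add: algebra_simps power2_eq_square)
next
  case (Suc K)
  define k where "k = Suc K"
  obtain d where m: "m = k + d"
    using Suc.prems k_def le_Suc_ex by blast
  define P Q where "P = p ^ k" and "Q = p ^ Suc d"
  have PQ: "p ^ Suc m = P * Q"
    by (simp add: P_def Q_def m power_add)
  have pp: "qpoch p p n \<noteq> 0" for n
    using pnz by (auto simp: qpoch_def)
  define D where "D = qpoch (p * P * x\<^sup>2) p m"
  have D: "D \<noteq> 0" 
    using nz[of "Suc _ + k"] by (auto simp: qpoch_def D_def P_def mult_ac power_add)
  \<comment> \<open>This is the common part of the three q-binomials below, which leave the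
    cofactors \<open>1 - P\<close>, \<open>1 - Q\<close> and \<open>1 - P * Q\<close>.\<close>
  define b where "b = qpoch p p m / (qpoch p p k * qpoch p p (Suc d))"
  have P1: "1 - P \<noteq> 0" and Q1: "1 - Q \<noteq> 0"
    using pnz[of K] pnz[of d] by (auto simp: P_def Q_def k_def)
  have nz1: "1 - P * x\<^sup>2 \<noteq> 0" and nz2: "1 - P * (P * Q) * x\<^sup>2 \<noteq> 0"
    using nz[of k] nz[of "k + Suc m"] by (simp_all add: P_def Q_def m power_add mult_ac)
  have b0: "qbinom p m K = b * (1 - P)" 
    using pp P1 by (simp add: qbinom_def b_def m k_def qpoch_Suc P_def)
  have b1: "qbinom p m k = b * (1 - Q)" 
    using pp Q1 by (simp add: qbinom_def b_def m qpoch_Suc Q_def)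
  have b2: "qbinom p (Suc m) k = b * (1 - P * Q)"
    using pp by (simp add: qbinom_def b_def m Suc_diff_le qpoch_Suc P_def Q_def power_add mult_ac)
  have 1: "qpoch (P * x\<^sup>2) p (Suc m) = (1 - P * x\<^sup>2) * D"
    by (simp add: qpoch_Suc_left D_def mult_ac)
  have 2: "qpoch (P * x\<^sup>2) p (Suc (Suc m)) = (1 - P * x\<^sup>2) * D * (1 - P * (P * Q) * x\<^sup>2)"
    by (simp add: qpoch_Suc_left[of _ _ "Suc m"], simp add: qpoch_Suc D_def PQ[symmetric] mult_ac)
  have 3: "qpoch (p * P * x\<^sup>2) p (Suc m) = D * (1 - P * (P * Q) * x\<^sup>2)"
    by (simp add: qpoch_Suc D_def PQ[symmetric] mult_ac)
  \<comment> \<open>The two summands and the two boundary fractions are all multiples of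
    \<open>E\<close>; their cofactors are the terms of
    \<open>quint_summand_certificate\<close>.\<close>
  define E where "E = b * x ^ k * p ^ k\<^sup>2 / ((1 - P * x\<^sup>2) * D * (1 - P * (P * Q) * x\<^sup>2))"
  have s2: "quint_summand x p (Suc m) k = E * ((1 + x * P) * (1 - P * Q))"
    unfolding quint_summand_def b2 P_def[symmetric] 2 by (simp add: E_def)
  have s1: "quint_summand x p m k = E * ((1 + x * P) * (1 - Q) * (1 - P * (P * Q) * x\<^sup>2))"
    unfolding quint_summand_def b1 P_def[symmetric] 1 using nz2 nz1 D by (simp add: E_def divide_simps)
  have e0: "p ^ (Suc m + K\<^sup>2 + K) = p ^ k\<^sup>2 * Q"
  proof -
    have "Suc m + K\<^sup>2 + K = k\<^sup>2 + Suc d"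
      by (simp add: m k_def power2_eq_square)
    thus ?thesis by (simp only: power_add Q_def)
  qed
  have g0: "qbinom p m K * x ^ Suc K * p ^ (Suc m + K\<^sup>2 + K) / qpoch (p ^ Suc K * x\<^sup>2) p (Suc m)
     = E * ((1 - P) * Q * (1 - P * (P * Q) * x\<^sup>2))"
    unfolding b0 e0 k_def[symmetric] P_def[symmetric] 1 using nz2 nz1 D by (simp add: E_def divide_simps)
  have e1: "p ^ (Suc m + k\<^sup>2 + k) = P * Q * p ^ k\<^sup>2 * P"
    unfolding power_add PQ P_def ..
  have g1: "qbinom p m k * x ^ Suc k * p ^ (Suc m + k\<^sup>2 + k) / qpoch (p ^ Suc k * x\<^sup>2) p (Suc m)
     = E * ((1 - Q) * (x * P * (P * Q)) * (1 - P * x\<^sup>2))"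
    unfolding b1 e1 power_Suc P_def[symmetric] 3 using nz2 nz1 D by (simp add: E_def divide_simps)
  have IH: "(1 - x * p ^ Suc m) * (\<Sum>k\<le>K. quint_summand x p (Suc m) k) =
      (\<Sum>k\<le>K. quint_summand x p m k) - E * ((1 - P) * Q * (1 - P * (P * Q) * x\<^sup>2))"
    using Suc unfolding g0 by simp
  have "(1 - x * p ^ Suc m) * (\<Sum>k\<le>Suc K. quint_summand x p (Suc m) k) =
      (1 - x * p ^ Suc m) * (\<Sum>k\<le>K. quint_summand x p (Suc m) k) 
      + E * ((1 + x * P) * (1 - P * Q) * (1 - x * (P * Q)))"
    unfolding sum.atMost_Suc unfolding k_def[symmetric] s2 PQ by (simp add: algebra_simps)
  also have "\<dots> = (\<Sum>k\<le>Suc K. quint_summand x p m k) - E * ((1 - Q) * (x * P * (P * Q)) * (1 - P * x\<^sup>2))"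
    unfolding IH quint_summand_certificate sum.atMost_Suc
    unfolding k_def[symmetric] s1 by (simp add: algebra_simps)
  finally show ?case
    unfolding k_def[symmetric] g1 .
qed

text \<open>At \<open>K = m\<close> the boundary fraction is exactly the missing term k = m + 1 of
  the upper sum, times the multiplier. Hence multiplying the sum for \<open>Suc m\<close> by
  \<open>1 - x * p ^ Suc m\<close> gives the sum for \<open>m\<close>, and induction
  applies.\<close>

lemma quint_summand_sum:
  fixes x p :: "'a::field"
  assumes nz: "\<And>i. 1 - x\<^sup>2 * p ^ i \<noteq> 0" and pnz: "\<And>i. p ^ Suc i \<noteq> 1"
  shows "qpoch x p (Suc m) * (\<Sum>k\<le>m. quint_summand x p m k) = 1"
proof (induction m)
  case 0
  have "1 - x \<noteq> 0" "1 - x\<^sup>2 = (1 - x) * (1 + x)" "1 + x \<noteq> 0"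
    using nz[of 0] by (auto simp: power2_eq_square algebra_simps add_eq_0_iff)
  then show ?case
    by (simp add: quint_summand_def qbinom_def qpoch_Suc)
next
  case (Suc m)
  let ?k = "Suc m"
  have pp: "qpoch p p n \<noteq> 0" for n
    using pnz by (auto simp: qpoch_def)
  have D: "qpoch (p ^ ?k * x\<^sup>2) p (Suc m) \<noteq> 0"
    using nz[of "_ + ?k"] by (auto simp: qpoch_def mult_ac power_add)
  \<comment> \<open>The last denominator factor of the top term is a difference of squares: one
    factor cancels the multiplier, the other the numerator \<open>1 + x * p ^ k\<close>.\<close>
  have e1: "1 - p ^ ?k * x\<^sup>2 * p ^ ?k = (1 - x * p ^ ?k) * (1 + x * p ^ ?k)"
    by (simp add: power2_eq_square algebra_simps)
  moreover have "1 - p ^ ?k * x\<^sup>2 * p ^ ?k \<noteq> 0"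
    using nz[of "?k + ?k"] by (simp only: power_add mult_ac not_False_eq_True)
  ultimately have nz1: "1 - x * p ^ ?k \<noteq> 0" "1 + x * p ^ ?k \<noteq> 0"
    by (metis mult_zero_left, metis mult_zero_right)
  have e2: "p ^ (Suc m + m\<^sup>2 + m) = p ^ ?k\<^sup>2"
    by (rule arg_cong[where f = "power p"]) (simp add: power2_eq_square)
  have "(1 - x * p ^ ?k) * quint_summand x p (Suc m) ?k =
      qbinom p m m * x ^ Suc m * p ^ (Suc m + m\<^sup>2 + m) / qpoch (p ^ Suc m * x\<^sup>2) p (Suc m)"
    unfolding quint_summand_def qpoch_Suc[of _ _ "Suc m"] e1 e2
    using D nz1 pp by (simp add: qbinom_def del: power_Suc)
  with quint_summand_telescope[OF nz pnz order.refl, of m]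
  have "(1 - x * p ^ ?k) * (\<Sum>k\<le>?k. quint_summand x p ?k k) = (\<Sum>k\<le>m. quint_summand x p m k)"
    by (simp only: sum.atMost_Suc distrib_left diff_add_cancel)
  then show ?case
    using Suc by (simp add: qpoch_Suc[of _ _ "Suc m"] mult_ac del: power_Suc)
qed

section \<open>Centring the finite identity\<close>

text \<open>The \<open>div\<close> is exact: \<open>j (3j - 1)\<close> is even.\<close>

definition quint_coeff :: "'a::field \<Rightarrow> 'a \<Rightarrow> int \<Rightarrow> 'a" where
  "quint_coeff z p j =
     (-1) powi j * z powi (3 * j) * p powi (j * (3 * j - 1) div 2) * (1 + z * p powi j)"

text \<open>These are the monomials left by the two reversals at \<open>x = z / p ^ n\<close>. With
  k = n + j and d = n - j the dependence on n cancels; for \<open>p\<close> this is k^2 + d(d+1)/2 -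
  n(n+1)/2 - nk = j(3j-1)/2.\<close>

lemma quint_coeff_shift:
  fixes z p :: "'a::field"
  assumes "p \<noteq> 0" "z \<noteq> 0" "k + d = 2 * n"
  shows "(-z) ^ n / p ^ (n * (n + 1) div 2) * ((1 + z / p ^ n * p ^ k) * (z / p ^ n) ^ k * p ^ k\<^sup>2)
           / ((-(z\<^sup>2)) ^ d / p ^ (d * (d + 1) div 2)) = quint_coeff z p (int k - int n)"
proof -
  define s t where "s = n * (n + 1) div 2" and "t = d * (d + 1) div 2"
  have st: "2 * s = n * (n + 1)" "2 * t = d * (d + 1)"
    by (simp_all add: s_def t_def)
  define j where "j = int k - int n"
  have k: "int k = int n + j" and d: "int d = int n - j"
    using assms(3) by (simp_all add: j_def)
  have "(-1) powi j = (-1::'a) ^ n / (-1) ^ d"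
  proof -
    have "j = int n - int d"
      by (simp add: d)
    then show ?thesis
      by (simp add: power_int_diff)
  qed
  moreover have "z powi (3 * j) = z ^ n * z ^ k / z ^ (2 * d)"
  proof -
    have "3 * j = int (n + k) - int (2 * d)"
      by (simp add: k d)
    then show ?thesis
      using power_int_diff[of z "int (n + k)" "int (2 * d)"] assms(2)
      by (simp only: power_int_of_nat power_add simp_thms)
  qed
  moreover have "p powi (j * (3 * j - 1) div 2) = p ^ k\<^sup>2 * p ^ t / (p ^ s * (p ^ n) ^ k)"
  proof -
    have "2 * int s = int n * (int n + 1)" "2 * int t = int d * (int d + 1)"
      using st by (metis of_nat_mult of_nat_add of_nat_1 of_nat_numeral)+
    then have "j * (3 * j - 1) = 2 * (int (k\<^sup>2 + t) - int (s + n * k))"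
      by (simp add: k d power2_eq_square algebra_simps)
    then have "j * (3 * j - 1) div 2 = int (k\<^sup>2 + t) - int (s + n * k)"
      by simp
    then show ?thesis
      using power_int_diff[of p "int (k\<^sup>2 + t)" "int (s + n * k)"] assms(1)
      by (simp only: power_int_of_nat power_add power_mult simp_thms)
  qed
  moreover have "p powi j = p ^ k / p ^ n"
    using assms by (simp add: j_def power_int_diff)
  moreover have "(-z) ^ n = (-1) ^ n * z ^ n" "(-(z\<^sup>2)) ^ d = (-1) ^ d * z ^ (2 * d)"
    by (metis power_minus, metis power_minus power_mult)
  ultimately show ?thesis
    unfolding j_def[symmetric] quint_coeff_def s_def[symmetric] t_def[symmetric]
    using assms(1,2) by (simp add: power_divide mult_ac)
qed

text \<open>In \<open>quint_summand_sum\<close> with \<open>m = 2 * n\<close> and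
  \<open>x = z / p ^ n\<close>, the outer product is cut after n factors and each denominator after
  2n - k factors; the lower pieces are reversed. The summand is then a coefficient in k - n times a
  sequence in k times a sequence in 2n - k.\<close>

lemma quintuple_finite:
  fixes z p :: "'a::field"
  assumes "p \<noteq> 0" "z \<noteq> 0" and nz: "\<And>j. z\<^sup>2 * p powi j \<noteq> 1" and pnz: "\<And>i. p ^ Suc i \<noteq> 1"
  shows "qpoch p p (2 * n) * qpoch z p (Suc n) * qpoch (p / z) p n *
    (\<Sum>k\<le>2*n. quint_coeff z p (int k - int n) *
       inverse (qpoch p p k * qpoch (z\<^sup>2) p (Suc k)) *
       inverse (qpoch p p (2 * n - k) * qpoch (p / z\<^sup>2) p (2 * n - k))) = 1"
proof -
  define x where "x = z / p ^ n"
  define C where "C = (-z) ^ n / p ^ (n * (n + 1) div 2)"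
  have "1 - x\<^sup>2 * p ^ i \<noteq> 0" for i
  proof -
    have "x\<^sup>2 * p ^ i = z\<^sup>2 * p powi (int i - int (n * 2))"
      using power_int_diff[of p "int i" "int (n * 2)"] assms(1)
      by (simp only: power_int_of_nat x_def power_divide power_mult) simp
    then show ?thesis
      using nz by simp
  qed
  from quint_summand_sum[OF this pnz, of "2 * n"]
  have "qpoch x p (Suc (2 * n)) * (\<Sum>k\<le>2*n. quint_summand x p (2 * n) k) = 1" .
  also have "qpoch x p (Suc (2 * n)) = C * qpoch (p / z) p n * qpoch z p (Suc n)"
    using qpoch_add[of x p n "Suc n"] qpoch_reverse[of p z n] assms
    by (simp add: x_def C_def mult_2)
  finally have 1: "(\<Sum>k\<le>2*n. C * qpoch (p / z) p n * qpoch z p (Suc n) * quint_summand x p (2 * n) k) = 1"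
    by (simp add: sum_distrib_left)
  show ?thesis
    unfolding 1[symmetric] sum_distrib_left
  proof (rule sum.cong)
    fix k assume "k \<in> {..2 * n}"
    then have k: "k + (2 * n - k) = 2 * n"
      by simp
    define d where "d = 2 * n - k"
    have k: "k + d = 2 * n"
      using k by (simp add: d_def)
    define E where "E = (-(z\<^sup>2)) ^ d / p ^ (d * (d + 1) div 2)"
    have "p ^ k * x\<^sup>2 = z\<^sup>2 / p ^ d"
    proof -
      have "(p ^ n)\<^sup>2 = p ^ k * p ^ d"
        using k by (metis power_add power_mult mult.commute)
      then show ?thesis
        using assms by (simp add: x_def power_divide)
    qed
    moreover have "Suc (2 * n) = d + Suc k"
      using k by simp
    ultimately have "qpoch (p ^ k * x\<^sup>2) p (Suc (2 * n)) = qpoch (z\<^sup>2 / p ^ d) p d * qpoch (z\<^sup>2) p (Suc k)"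
      using qpoch_add[of "z\<^sup>2 / p ^ d" p d "Suc k"] assms by simp
    also have "qpoch (z\<^sup>2 / p ^ d) p d = E * qpoch (p / z\<^sup>2) p d"
      using qpoch_reverse[of p "z\<^sup>2" d] assms by (simp add: E_def)
    finally have den: "qpoch (p ^ k * x\<^sup>2) p (Suc (2 * n)) =
        E * qpoch (p / z\<^sup>2) p d * qpoch (z\<^sup>2) p (Suc k)" .
    have "quint_coeff z p (int k - int n) = C * ((1 + x * p ^ k) * x ^ k * p ^ k\<^sup>2) / E"
      unfolding C_def E_def x_def by (rule quint_coeff_shift[OF assms(1,2) k, symmetric])
    then show "qpoch p p (2 * n) * qpoch z p (Suc n) * qpoch (p / z) p n *
       (quint_coeff z p (int k - int n) *
       inverse (qpoch p p k * qpoch (z\<^sup>2) p (Suc k)) *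
       inverse (qpoch p p (2 * n - k) * qpoch (p / z\<^sup>2) p (2 * n - k))) =
       C * qpoch (p / z) p n * qpoch z p (Suc n) * quint_summand x p (2 * n) k"
      unfolding quint_summand_def den qbinom_def d_def[symmetric]
      by (simp add: divide_inverse mult_ac)
  qed simp
qed

section \<open>Passage to the limit\<close>

lemma
  assumes "norm p < 1"
  shows qpoch_tendsto: "qpoch a p \<longlonglongrightarrow> qpoch_inf a p"
    and qpoch_inf_nonzero: "(\<And>i. a * p ^ i \<noteq> 1) \<Longrightarrow> qpoch_inf a p \<noteq> 0"
proof -
  have "summable (\<lambda>i. norm ((1 - a * p ^ i) - 1))"
    using assms by (simp add: norm_mult norm_power summable_mult summable_geometric)
  then have conv: "convergent_prod (\<lambda>i. 1 - a * p ^ i)"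
    by (intro abs_convergent_prod_imp_convergent_prod summable_imp_abs_convergent_prod)
  have "(\<lambda>n. qpoch a p (Suc n)) \<longlonglongrightarrow> qpoch_inf a p"
    using convergent_prod_LIMSEQ[OF conv] by (simp add: qpoch_def qpoch_inf_def lessThan_Suc_atMost)
  then show "qpoch a p \<longlonglongrightarrow> qpoch_inf a p"
    by (simp add: filterlim_sequentially_Suc)
  show "qpoch_inf a p \<noteq> 0" if "\<And>i. a * p ^ i \<noteq> 1"
    unfolding qpoch_inf_def by (rule prodinf_nonzero[OF conv]) (use that in auto)
qed

lemma sum_symmetric_int:
  fixes f :: "int \<Rightarrow> 'a::comm_monoid_add"
  shows "(\<Sum>j=-int n..int n. f j) = f 0 + (\<Sum>i<n. f (int (Suc i)) + f (- int (Suc i)))"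
proof (induction n)
  case (Suc n)
  have "{- int (Suc n)..int (Suc n)} = insert (int (Suc n)) (insert (- int (Suc n)) {-int n..int n})"
    by auto
  then show ?case
    using Suc by (simp add: add_ac)
qed simp

text \<open>For fixed j = k - n, both n + j and n - j tend to infinity, so each term tends to
  \<open>c j * y * v\<close>. Since \<open>Y\<close> and \<open>V\<close> are bounded, the
  coefficients dominate and Tannery's theorem applies. The limit of the coefficient sums stays an
  unevaluated \<open>lim\<close>, as its value is found only in
  \<open>quintuple_product\<close>.\<close>

lemma tendsto_convolution_symmetric:
  fixes c :: "int \<Rightarrow> complex" and Y V :: "nat \<Rightarrow> complex"
  assumes Y: "Y \<longlonglongrightarrow> y" and V: "V \<longlonglongrightarrow> v"
    and c: "summable (\<lambda>i. norm (c (int i)))" "summable (\<lambda>i. norm (c (- int i)))"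
  shows "convergent (\<lambda>n. \<Sum>j=-int n..int n. c j)"
    and "(\<lambda>n. \<Sum>k\<le>2*n. c (int k - int n) * Y k * V (2 * n - k))
           \<longlonglongrightarrow> lim (\<lambda>n. \<Sum>j=-int n..int n. c j) * y * v"
proof -
  define e where "e i = c (int (Suc i)) + c (- int (Suc i))" for i
  have c': "summable (\<lambda>i. norm (c (int (Suc i))))" "summable (\<lambda>i. norm (c (- int (Suc i))))"
    by (rule iffD2[OF summable_Suc_iff, OF c(1)], rule iffD2[OF summable_Suc_iff, OF c(2)])
  have e: "summable e"
    unfolding e_def by (intro summable_add c'[THEN summable_norm_cancel])
  have lim: "(\<lambda>n. \<Sum>j=-int n..int n. c j) \<longlonglongrightarrow> c 0 + suminf e"
    unfolding sum_symmetric_int e_def[symmetric] by (intro tendsto_intros summable_LIMSEQ e)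
  then show "convergent (\<lambda>n. \<Sum>j=-int n..int n. c j)"
    by (rule convergentI)
  \<comment> \<open>Pairing j with -j gives a one-sided series; padding with 0 for
    \<open>i \<ge> n\<close> makes the finite sum a full series and keeps the subtraction
    \<open>n - Suc i\<close> from truncating.\<close>
  define f where "f i n = (if i < n then
      c (int (Suc i)) * Y (n + Suc i) * V (n - Suc i) +
      c (- int (Suc i)) * Y (n - Suc i) * V (n + Suc i) else 0)" for i n
  have sum_eq: "(\<Sum>k\<le>2*n. c (int k - int n) * Y k * V (2 * n - k)) = c 0 * Y n * V n + (\<Sum>i. f i n)" for n
  proof -
    have "(\<Sum>k\<le>2*n. c (int k - int n) * Y k * V (2 * n - k)) =
        (\<Sum>j=-int n..int n. c j * Y (nat (int n + j)) * V (nat (int n - j)))"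
      by (rule sum.reindex_bij_witness[of _ "\<lambda>j. nat (int n + j)" "\<lambda>k. int k - int n"])
         (auto simp: nat_diff_distrib nat_mult_distrib algebra_simps)
    also have "\<dots> = c 0 * Y n * V n + (\<Sum>i<n. f i n)"
    proof -
      have "nat (int n + int (Suc i)) = n + Suc i" "nat (int n + - int (Suc i)) = n - Suc i"
        "nat (int n - int (Suc i)) = n - Suc i" "nat (int n - - int (Suc i)) = n + Suc i" for i
        by linarith+
      then show ?thesis
        unfolding sum_symmetric_int by (simp add: f_def del: of_nat_Suc)
    qed
    also have "(\<Sum>i<n. f i n) = (\<Sum>i. f i n)"
      by (rule suminf_finite[symmetric]) (auto simp: f_def)
    finally show ?thesis .
  qed
  obtain BY where BY: "\<And>n. norm (Y n) \<le> BY"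
    using convergent_imp_Bseq[OF convergentI[OF Y]] by (auto simp: Bseq_def)
  obtain BV where BV: "\<And>n. norm (V n) \<le> BV"
    using convergent_imp_Bseq[OF convergentI[OF V]] by (auto simp: Bseq_def)
  have nn: "0 \<le> BY" "0 \<le> BV"
    using BY[of 0] BV[of 0] norm_ge_zero order_trans by blast+
  define M where "M i = (norm (c (int (Suc i))) + norm (c (- int (Suc i)))) * (BY * BV)" for i
  have bd: "norm (a * Y m * V l) \<le> norm a * (BY * BV)" for a m l
    unfolding norm_mult mult.assoc using BY BV nn by (intro mult_left_mono mult_mono) auto
  have bound: "norm (f i n) \<le> M i" for i n
  proof (cases "i < n")
    case True
    then show ?thesis
      unfolding f_def M_def distrib_right
      by (auto intro!: order_trans[OF norm_triangle_ineq] add_mono bd)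
  qed (use nn in \<open>simp add: f_def M_def\<close>)
  have M: "summable M"
    unfolding M_def using c' by (intro summable_mult2 summable_add)
  have flim: "(\<lambda>n. f i n) \<longlonglongrightarrow> e i * (y * v)" for i
  proof (rule Lim_transform_eventually)
    have s: "(\<lambda>n. W (n + Suc i)) \<longlonglongrightarrow> w" "(\<lambda>n. W (n - Suc i)) \<longlonglongrightarrow> w" if "W \<longlonglongrightarrow> w" for W :: "nat \<Rightarrow> complex" and w
    proof -
      show "(\<lambda>n. W (n + Suc i)) \<longlonglongrightarrow> w"
        using that by (rule LIMSEQ_ignore_initial_segment)
      show "(\<lambda>n. W (n - Suc i)) \<longlonglongrightarrow> w"
        by (rule filterlim_compose[OF that]) (rule filterlim_minus_const_nat_at_top)
    qed
    show "(\<lambda>n. c (int (Suc i)) * Y (n + Suc i) * V (n - Suc i) +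
      c (- int (Suc i)) * Y (n - Suc i) * V (n + Suc i)) \<longlonglongrightarrow> e i * (y * v)"
      unfolding e_def distrib_right mult.assoc[symmetric]
      by (intro tendsto_intros s Y V)
    show "\<forall>\<^sub>F n in sequentially. c (int (Suc i)) * Y (n + Suc i) * V (n - Suc i) +
      c (- int (Suc i)) * Y (n - Suc i) * V (n + Suc i) = f i n"
      using eventually_gt_at_top[of i] by eventually_elim (simp add: f_def)
  qed
  have "(\<lambda>n. \<Sum>i. f i n) \<longlonglongrightarrow> (\<Sum>i. e i * (y * v))"
    using tannerys_theorem[of f "\<lambda>i. e i * (y * v)" sequentially M] flim bound M
    by (simp add: always_eventually)
  also have "(\<Sum>i. e i * (y * v)) = suminf e * (y * v)"
    using e by (rule suminf_mult2[symmetric])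
  finally have "(\<lambda>n. c 0 * Y n * V n + (\<Sum>i. f i n)) \<longlonglongrightarrow> c 0 * y * v + suminf e * (y * v)"
    by (intro tendsto_intros Y V)
  then show "(\<lambda>n. \<Sum>k\<le>2*n. c (int k - int n) * Y k * V (2 * n - k))
           \<longlonglongrightarrow> lim (\<lambda>n. \<Sum>j=-int n..int n. c j) * y * v"
    unfolding limI[OF lim] sum_eq by (simp add: algebra_simps)
qed

section \<open>Summability and the quintuple product identity\<close>

text \<open>Expanding gives two monomials, with exponent of \<open>p\<close> at least j^2 and
  exponent of \<open>z\<close> at most 3|j| + 1 in absolute value. \<open>M\<close> bounds both
  \<open>z\<close> and its inverse, which covers either sign of j. The bound is written as a |j|-th
  power whose base tends to 0, ready for comparison with a geometric series.\<close>

lemma norm_quint_coeff_le: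
  fixes z p :: complex
  assumes "z \<noteq> 0" "p \<noteq> 0" "norm p < 1" and M: "M = max (norm z) (inverse (norm z))"
  shows "norm (quint_coeff z p j) \<le> 2 * M * (M ^ 3 * norm p ^ nat \<bar>j\<bar>) ^ nat \<bar>j\<bar>"
proof -
  have M1: "1 \<le> M"
    using assms(1) one_le_inverse[of "norm z"] by (cases "norm z \<le> 1") (auto simp: M le_max_iff_disj)
  have zM: "norm (z powi m) \<le> M ^ l" if "nat \<bar>m\<bar> \<le> l" for m l
  proof -
    have "norm (z powi m) \<le> M ^ nat \<bar>m\<bar>"
    proof (cases m rule: int_cases4)
      case (nonneg n)
      then show ?thesis
        by (simp add: norm_power M power_mono)
    next
      case (neg n)
      then show ?thesis
        by (simp add: power_int_minus norm_inverse norm_power M power_mono flip: power_inverse)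
    qed
    also have "\<dots> \<le> M ^ l"
      using that M1 by (rule power_increasing)
    finally show ?thesis .
  qed
  have pr: "norm (p powi m) \<le> norm p ^ (nat \<bar>j\<bar> * nat \<bar>j\<bar>)" if "j * j \<le> m" for m
  proof -
    have "0 \<le> m"
      using that zero_le_square order_trans by blast
    moreover have "nat \<bar>j\<bar> * nat \<bar>j\<bar> = nat (j * j)"
      by (simp flip: nat_mult_distrib)
    then have "nat \<bar>j\<bar> * nat \<bar>j\<bar> \<le> nat m"
      using that by (simp add: nat_mono)
    ultimately show ?thesis
      using assms(3) by (simp add: power_int_nonneg_exp norm_power power_decreasing)
  qed
  define e where "e = j * (3 * j - 1) div 2"
  have e2: "2 * e = j * (3 * j - 1)"
    by (simp add: e_def)
  have jj: "\<bar>j\<bar> \<le> j * j"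
    using mult_left_mono[of 1 "\<bar>j\<bar>" "\<bar>j\<bar>"] by (cases "j = 0") (simp_all add: abs_mult_self_eq)
  have e: "j * j \<le> e" "j * j \<le> e + j"
    using e2 jj by (simp_all add: algebra_simps abs_le_iff)
  have "quint_coeff z p j = (-1) powi j * (z powi (3 * j) * p powi e + z powi (3 * j + 1) * p powi (e + j))"
    using assms(1,2) by (simp add: quint_coeff_def e_def power_int_add algebra_simps)
  then have "norm (quint_coeff z p j) = norm (z powi (3 * j) * p powi e + z powi (3 * j + 1) * p powi (e + j))"
    by (simp add: norm_mult norm_power_int)
  also have "\<dots> \<le> norm (z powi (3 * j)) * norm (p powi e) + norm (z powi (3 * j + 1)) * norm (p powi (e + j))"
    using norm_triangle_ineq by (metis norm_mult)
  also have "\<dots> \<le> M ^ (3 * nat \<bar>j\<bar> + 1) * norm p ^ (nat \<bar>j\<bar> * nat \<bar>j\<bar>) + M ^ (3 * nat \<bar>j\<bar> + 1) * norm p ^ (nat \<bar>j\<bar> * nat \<bar>j\<bar>)"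
    using M1 by (intro add_mono mult_mono zM pr e) auto
  also have "\<dots> = 2 * M * (M ^ 3 * norm p ^ nat \<bar>j\<bar>) ^ nat \<bar>j\<bar>"
    by (simp add: power_add power_mult power_mult_distrib)
  finally show ?thesis .
qed

lemma summable_quint_coeff:
  fixes z p :: complex
  assumes "z \<noteq> 0" "p \<noteq> 0" "norm p < 1"
  shows "summable (\<lambda>i. norm (quint_coeff z p (int i)))" "summable (\<lambda>i. norm (quint_coeff z p (- int i)))"
proof -
  define M where "M = max (norm z) (inverse (norm z))"
  have M0: "0 \<le> M"
    by (simp add: M_def le_max_iff_disj)
  have "(\<lambda>i. M ^ 3 * norm p ^ i) \<longlonglongrightarrow> M ^ 3 * 0"
    using assms by (intro tendsto_mult tendsto_const LIMSEQ_power_zero) simp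
  then have ev: "\<forall>\<^sub>F i in sequentially. M ^ 3 * norm p ^ i < 1/2"
    by (rule order_tendstoD) simp
  have sm: "summable (\<lambda>i. 2 * M * (1/2) ^ i)"
    by (intro summable_mult summable_geometric) simp
  have le: "norm (norm (quint_coeff z p j)) \<le> 2 * M * (1/2) ^ i"
    if "M ^ 3 * norm p ^ i < 1/2" "nat \<bar>j\<bar> = i" for i j
  proof -
    have "norm (quint_coeff z p j) \<le> 2 * M * (M ^ 3 * norm p ^ i) ^ i"
      using norm_quint_coeff_le[OF assms M_def, of j] that by simp
    also have "\<dots> \<le> 2 * M * (1/2) ^ i"
      using that M0 by (intro mult_left_mono power_mono) auto
    finally show ?thesis by simp
  qed
  show "summable (\<lambda>i. norm (quint_coeff z p (int i)))"
    by (intro summable_comparison_test_ev[OF _ sm] eventually_mono[OF ev] le) simp_all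
  show "summable (\<lambda>i. norm (quint_coeff z p (- int i)))"
    by (intro summable_comparison_test_ev[OF _ sm] eventually_mono[OF ev] le) simp_all
qed

theorem quintuple_product:
  fixes z p :: complex
  assumes p: "p \<noteq> 0" "norm p < 1" and z: "z \<noteq> 0" and nz: "\<And>j. z\<^sup>2 * p powi j \<noteq> 1"
  shows "(\<lambda>n. \<Sum>j=-int n..int n. quint_coeff z p j) \<longlonglongrightarrow>
    qpoch_inf p p * qpoch_inf (z\<^sup>2) p * qpoch_inf (p / z\<^sup>2) p / (qpoch_inf z p * qpoch_inf (p / z) p)"
proof -
  define L where "L = lim (\<lambda>n. \<Sum>j=-int n..int n. quint_coeff z p j)"
  have pnz: "p ^ Suc i \<noteq> 1" for i
    using p power_Suc_less_one[of "norm p" i] by (metis norm_ge_zero norm_one norm_power less_irrefl power_Suc_less_one zero_less_norm_iff)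
  have P: "qpoch_inf p p \<noteq> 0"
    using p(2) by (rule qpoch_inf_nonzero) (use pnz in simp)
  have Z: "qpoch_inf (z\<^sup>2) p \<noteq> 0"
    using p(2) by (rule qpoch_inf_nonzero) (use nz[of "int _"] in simp)
  \<comment> \<open>The left side is the inverse of
    \<open>z\<^sup>2 * p powi (- int (Suc i))\<close>, so \<open>nz\<close> at a negative index
    excludes the value 1.\<close>
  have "p / z\<^sup>2 * p ^ i \<noteq> 1" for i
    using nz[of "- int (Suc i)"] z p by (auto simp: power_int_minus field_simps simp del: of_nat_Suc)
  then have W: "qpoch_inf (p / z\<^sup>2) p \<noteq> 0"
    by (rule qpoch_inf_nonzero[OF p(2)])
  have lim2: "(\<lambda>n. F (2 * n)) \<longlonglongrightarrow> l" if "F \<longlonglongrightarrow> l" for F :: "nat \<Rightarrow> complex" and l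
    using LIMSEQ_subseq_LIMSEQ[OF that, of "\<lambda>n. 2 * n"] by (simp add: strict_mono_def o_def)
  note lims = qpoch_tendsto[OF p(2)] lim2[OF qpoch_tendsto[OF p(2)]] LIMSEQ_Suc[OF qpoch_tendsto[OF p(2)]]
  have Y: "(\<lambda>k. inverse (qpoch p p k * qpoch (z\<^sup>2) p (Suc k))) \<longlonglongrightarrow>
      inverse (qpoch_inf p p * qpoch_inf (z\<^sup>2) p)"
    by (intro tendsto_inverse tendsto_mult lims) (simp add: P Z)
  have V: "(\<lambda>k. inverse (qpoch p p k * qpoch (p / z\<^sup>2) p k)) \<longlonglongrightarrow>
      inverse (qpoch_inf p p * qpoch_inf (p / z\<^sup>2) p)"
    by (intro tendsto_inverse tendsto_mult lims) (simp add: P W)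
  have c: "convergent (\<lambda>n. \<Sum>j=-int n..int n. quint_coeff z p j)"
    and l: "(\<lambda>n. \<Sum>k\<le>2*n. quint_coeff z p (int k - int n) *
       inverse (qpoch p p k * qpoch (z\<^sup>2) p (Suc k)) *
       inverse (qpoch p p (2 * n - k) * qpoch (p / z\<^sup>2) p (2 * n - k))) \<longlonglongrightarrow>
     L * inverse (qpoch_inf p p * qpoch_inf (z\<^sup>2) p) * inverse (qpoch_inf p p * qpoch_inf (p / z\<^sup>2) p)"
    unfolding L_def
    using tendsto_convolution_symmetric[OF Y V summable_quint_coeff[OF z p]] by blast+
  have "(\<lambda>n. qpoch p p (2 * n) * qpoch z p (Suc n) * qpoch (p / z) p n *
    (\<Sum>k\<le>2*n. quint_coeff z p (int k - int n) *
       inverse (qpoch p p k * qpoch (z\<^sup>2) p (Suc k)) *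
       inverse (qpoch p p (2 * n - k) * qpoch (p / z\<^sup>2) p (2 * n - k)))) \<longlonglongrightarrow>
    qpoch_inf p p * qpoch_inf z p * qpoch_inf (p / z) p *
    (L * inverse (qpoch_inf p p * qpoch_inf (z\<^sup>2) p) * inverse (qpoch_inf p p * qpoch_inf (p / z\<^sup>2) p))"
    by (intro tendsto_mult lims l)
  then have "(\<lambda>n. 1) \<longlonglongrightarrow> qpoch_inf p p * qpoch_inf z p * qpoch_inf (p / z) p *
    (L * inverse (qpoch_inf p p * qpoch_inf (z\<^sup>2) p) * inverse (qpoch_inf p p * qpoch_inf (p / z\<^sup>2) p))"
    unfolding quintuple_finite[OF p(1) z nz pnz] .
  then have eq: "1 = qpoch_inf p p * qpoch_inf z p * qpoch_inf (p / z) p *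
    (L * inverse (qpoch_inf p p * qpoch_inf (z\<^sup>2) p) * inverse (qpoch_inf p p * qpoch_inf (p / z\<^sup>2) p))"
    by (simp add: LIMSEQ_const_iff)
  \<comment> \<open>Both are factors of a product equal to 1.\<close>
  then have "qpoch_inf z p \<noteq> 0" "qpoch_inf (p / z) p \<noteq> 0"
    by auto
  then have "L = qpoch_inf p p * qpoch_inf (z\<^sup>2) p * qpoch_inf (p / z\<^sup>2) p / (qpoch_inf z p * qpoch_inf (p / z) p)"
    using eq P Z W by (simp add: field_simps)
  then show ?thesis
    using c unfolding L_def by (metis convergent_LIMSEQ_iff)
qed

section \<open>Rewriting the product side\<close>

text \<open>The indices below m * n are sorted by their residue modulo m.\<close>

lemma qpoch_dissect: "qpoch a q (m * n) = (\<Prod>r<m. qpoch (a * q ^ r) (q ^ m) n)"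
proof (induction n)
  case (Suc n)
  have "qpoch a q (m * Suc n) = qpoch a q (m * n) * qpoch (a * q ^ (m * n)) q m"
    using qpoch_add[of a q "m * n" m] by (simp add: add.commute)
  also have "qpoch (a * q ^ (m * n)) q m = (\<Prod>r<m. 1 - a * q ^ r * (q ^ m) ^ n)"
    by (simp add: qpoch_def mult_ac power_mult)
  finally show ?case
    by (simp add: Suc qpoch_Suc prod.distrib)
qed simp

lemma qpoch_inf_dissect:
  assumes "norm q < 1" "m > 0"
  shows "qpoch_inf a q = (\<Prod>r<m. qpoch_inf (a * q ^ r) (q ^ m))"
proof (rule LIMSEQ_unique)
  have "norm (q ^ m) < 1"
    using assms by (simp add: norm_power power_less_one_iff)
  then show "(\<lambda>n. \<Prod>r<m. qpoch (a * q ^ r) (q ^ m) n) \<longlonglongrightarrow> (\<Prod>r<m. qpoch_inf (a * q ^ r) (q ^ m))"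
    by (intro tendsto_prod qpoch_tendsto)
  have "strict_mono (\<lambda>n. m * n)"
    using assms by (simp add: strict_mono_def)
  from LIMSEQ_subseq_LIMSEQ[OF qpoch_tendsto[OF assms(1)] this]
  show "(\<lambda>n. \<Prod>r<m. qpoch (a * q ^ r) (q ^ m) n) \<longlonglongrightarrow> qpoch_inf a q"
    by (simp add: o_def qpoch_dissect)
qed

text \<open>Everything is brought to base \<open>q ^ 10\<close>: the numerator
  \<open>qpoch_inf (q ^ 2) (q ^ 2)\<close> splits into five products and the denominator into four;
  those starting at \<open>q ^ 4\<close> and \<open>q ^ 6\<close> cancel.\<close>

lemma theta_quotient_eq:
  fixes q :: complex
  assumes q: "norm q < 1"
  shows "qpochs_inf [q ^ 2, q ^ 6, q ^ 8] (q ^ 8) * qpochs_inf [q ^ 4, q ^ 12] (q ^ 16)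
      / qpochs_inf [q, q ^ 4] (q ^ 5) =
    qpoch_inf (q ^ 10) (q ^ 10) * qpoch_inf (q ^ 2) (q ^ 10) * qpoch_inf (q ^ 8) (q ^ 10)
      / (qpoch_inf q (q ^ 10) * qpoch_inf (q ^ 9) (q ^ 10))"
proof -
  have lt: "norm (q ^ k) < 1" if "k > 0" for k
    using q that by (simp add: norm_power power_less_one_iff)
  have two: "qpoch_inf (q ^ a) (q ^ k) = qpoch_inf (q ^ a) (q ^ (2 * k)) * qpoch_inf (q ^ (a + k)) (q ^ (2 * k))"
    if "k > 0" for a k
    using qpoch_inf_dissect[OF lt[OF that], of 2 "q ^ a"]
    by (simp add: numeral_2_eq_2 power_add mult.commute flip: power_mult)
  have nz: "qpoch_inf (q ^ a) (q ^ k) \<noteq> 0" if "a > 0" "k > 0" for a k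
  proof (rule qpoch_inf_nonzero[OF lt[OF that(2)]])
    fix i
    have "norm (q ^ (a + k * i)) < 1"
      using that by (intro lt) simp
    then show "q ^ a * (q ^ k) ^ i \<noteq> 1"
      by (metis norm_one less_irrefl power_add power_mult)
  qed
  have five: "qpoch_inf (q ^ 2) (q ^ 2) = qpoch_inf (q ^ 2) (q ^ 10) * qpoch_inf (q ^ 4) (q ^ 10) *
      qpoch_inf (q ^ 6) (q ^ 10) * qpoch_inf (q ^ 8) (q ^ 10) * qpoch_inf (q ^ 10) (q ^ 10)"
  proof -
    define F where "F r = qpoch_inf (q ^ (2 + 2 * r)) (q ^ 10)" for r
    have "(q ^ 2) ^ 5 = q ^ 10"
      by (simp flip: power_mult)
    then have "qpoch_inf (q ^ 2 * (q ^ 2) ^ r) ((q ^ 2) ^ 5) = F r" for r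
      by (simp only: F_def power_add power_mult)
    then have "qpoch_inf (q ^ 2) (q ^ 2) = (\<Prod>r<5. F r)"
      using qpoch_inf_dissect[OF lt[of 2], of 5 "q ^ 2"] by simp
    also have "\<dots> = F 0 * F 1 * F 2 * F 3 * F 4"
      by (simp add: lessThan_nat_numeral lessThan_Suc mult_ac)
    finally show ?thesis
      by (simp add: F_def)
  qed
  have num: "qpochs_inf [q ^ 2, q ^ 6, q ^ 8] (q ^ 8) * qpochs_inf [q ^ 4, q ^ 12] (q ^ 16)
      = qpoch_inf (q ^ 2) (q ^ 2)"
    \<comment> \<open>The instances of \<open>two\<close> list \<open>k\<close> before
      \<open>a\<close>; each doubles the base, from \<open>q ^ 2\<close> through
      \<open>q ^ 4\<close> and \<open>q ^ 8\<close> up to \<open>q ^ 16\<close>.\<close>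
    using two[of 2 2] two[of 4 2] two[of 4 4] two[of 8 4] by (simp add: qpochs_inf_def)
  have den: "qpochs_inf [q, q ^ 4] (q ^ 5) =
      qpoch_inf q (q ^ 10) * qpoch_inf (q ^ 6) (q ^ 10) * qpoch_inf (q ^ 4) (q ^ 10) * qpoch_inf (q ^ 9) (q ^ 10)"
    using two[of 5 1] two[of 5 4] by (simp add: qpochs_inf_def)
  show ?thesis
    unfolding num den five using nz[of 6 10] nz[of 4 10] nz[of 1 10] nz[of 9 10]
    by (simp add: field_simps)
qed

section \<open>Enumerating the exponents\<close>

text \<open>By strong induction and injectivity, \<open>enumerate S n = f a\<close> and
  \<open>f n = enumerate S b\<close> with \<open>a\<close> and \<open>b\<close> at least n.
  Monotonicity closes the circle: \<open>enumerate S n \<le> enumerate S b = f n \<le> f a =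
  enumerate S n\<close>.\<close>

lemma enumerate_eqI:
  fixes S :: "nat set"
  assumes f: "strict_mono f" and S: "range f = S"
  shows "enumerate S = f"
proof
  have inf: "infinite S"
    using f S by (metis finite_imageD infinite_UNIV_nat strict_mono_imp_inj_on)
  fix n show "enumerate S n = f n"
  proof (induction n rule: less_induct)
    case (less n)
    obtain a where a: "enumerate S n = f a"
      using enumerate_in_set[OF inf, of n] S by auto
    obtain b where b: "f n = enumerate S b"
      using enumerate_Ex[OF inf, of "f n"] S by (metis rangeI)
    have "n \<le> a"
      using less[of a] a inj_enumerate[OF inf] by (metis injD not_le less_irrefl)
    moreover have "n \<le> b"
      using less[of b] b f by (metis strict_mono_eq not_le less_irrefl)
    ultimately show ?case
      using a b f inf by (metis enumerate_mono_le_iff order_antisym strict_mono_less_eq)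
  qed
qed

text \<open>The residues 1, 4, 11, 14 are the square roots of 1 modulo 15.\<close>

definition square_root_seq :: "nat \<Rightarrow> nat" where
  "square_root_seq n = 15 * (n div 4) + [1, 4, 11, 14] ! (n mod 4)"

text \<open>For i = n div 4 and such a residue r this is ((15i + r)^2 - 1)/15 = 15i^2 + 2ri + (r^2 -
  1)/15.\<close>

definition square_index_seq :: "nat \<Rightarrow> nat" where
  "square_index_seq n =
     15 * (n div 4)\<^sup>2 + [2, 8, 22, 28] ! (n mod 4) * (n div 4) + [0, 1, 8, 13] ! (n mod 4)"

lemma mod_4_cases:
  fixes n :: nat
  obtains i where "n = 4 * i" | i where "n = 4 * i + 1" | i where "n = 4 * i + 2" | i where "n = 4 * i + 3"
proof -
  have "n = 4 * (n div 4) \<or> n = 4 * (n div 4) + 1 \<or> n = 4 * (n div 4) + 2 \<or> n = 4 * (n div 4) + 3"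
    by presburger
  then show thesis
    using that by blast
qed

lemma div_mod_4: "r < 4 \<Longrightarrow> (4 * i + r) div 4 = i \<and> (4 * i + r) mod 4 = (r::nat)"
  by simp

lemma square_root_seq_simps [simp]:
  "square_root_seq (4 * i) = 15 * i + 1"
  "square_root_seq (4 * i + 1) = 15 * i + 4"
  "square_root_seq (4 * i + 2) = 15 * i + 11"
  "square_root_seq (4 * i + 3) = 15 * i + 14"
  using div_mod_4[of 1 i] div_mod_4[of 2 i] div_mod_4[of 3 i]
  by (simp_all add: square_root_seq_def)

lemma square_index_seq_simps [simp]:
  "square_index_seq (4 * i) = 15 * i\<^sup>2 + 2 * i"
  "square_index_seq (4 * i + 1) = 15 * i\<^sup>2 + 8 * i + 1"
  "square_index_seq (4 * i + 2) = 15 * i\<^sup>2 + 22 * i + 8"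
  "square_index_seq (4 * i + 3) = 15 * i\<^sup>2 + 28 * i + 13"
  using div_mod_4[of 1 i] div_mod_4[of 2 i] div_mod_4[of 3 i]
  by (simp_all add: square_index_seq_def)

lemma square_index_seq_eq: "15 * square_index_seq n + 1 = (square_root_seq n)\<^sup>2"
  by (cases n rule: mod_4_cases; hypsubst; simp only: square_index_seq_simps square_root_seq_simps)
     (simp_all add: power2_eq_square algebra_simps)

lemma strict_mono_square_root_seq: "strict_mono square_root_seq"
proof (rule strict_mono_Suc_iff[THEN iffD2], rule allI)
  fix n show "square_root_seq n < square_root_seq (Suc n)"
  proof (cases n rule: mod_4_cases)
    case (4 i)
    then have "Suc n = 4 * (i + 1)"
      by simp
    then show ?thesis
      using 4 by (simp only: square_root_seq_simps)
  qed (use square_root_seq_simps in \<open>simp_all add: numeral_eq_Suc\<close>)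
qed

lemma strict_mono_square_index_seq: "strict_mono square_index_seq"
proof (rule strict_monoI)
  fix m n :: nat assume "m < n"
  then have "square_root_seq m < square_root_seq n"
    using strict_mono_square_root_seq by (simp add: strict_mono_less)
  then have "(square_root_seq m)\<^sup>2 < (square_root_seq n)\<^sup>2"
    by (simp add: power_strict_mono)
  then show "square_index_seq m < square_index_seq n"
    unfolding square_index_seq_eq[symmetric] by simp
qed

lemma range_square_index_seq: "range square_index_seq = square_index_set"
proof
  show "range square_index_seq \<subseteq> square_index_set"
    unfolding square_index_set_def using square_index_seq_eq by blast
  show "square_index_set \<subseteq> range square_index_seq"
  proof
    fix m assume "m \<in> square_index_set"
    then obtain k where k: "15 * m + 1 = k\<^sup>2"
      by (auto simp: square_index_set_def)
    have "k\<^sup>2 mod 15 = 1"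
      unfolding k[symmetric] by simp
    then have "((k mod 15)\<^sup>2) mod 15 = 1"
      by (simp add: power_mod)
    moreover have "k mod 15 \<in> {..<15}"
      by simp
    ultimately have "k mod 15 \<in> {1, 4, 11, 14}"
      by (auto simp: lessThan_nat_numeral lessThan_Suc)
    moreover have "k = 15 * (k div 15) + k mod 15"
      by simp
    ultimately have "\<exists>n. k = square_root_seq n"
      using square_root_seq_simps[of "k div 15"] by (metis insert_iff empty_iff)
    then obtain n where "k = square_root_seq n" ..
    with k square_index_seq_eq[of n] have "m = square_index_seq n"
      by simp
    then show "m \<in> range square_index_seq"
      by simp
  qed
qed

lemma enumerate_square_index_set: "enumerate square_index_set = square_index_seq"
  by (rule enumerate_eqI[OF strict_mono_square_index_seq range_square_index_seq])

section \<open>Matching the two series\<close>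

lemma quint_coeff_power_10:
  fixes q :: "'a::field"
  assumes "q \<noteq> 0"
  shows "quint_coeff q (q ^ 10) j =
    (-1) powi j * (q powi (15 * j\<^sup>2 - 2 * j) + q powi (15 * j\<^sup>2 + 8 * j + 1))"
proof -
  define e where "e = j * (3 * j - 1) div 2"
  have "2 * e = j * (3 * j - 1)"
    by (simp add: e_def)
  then have e: "15 * j\<^sup>2 - 2 * j = 3 * j + 10 * e" "15 * j\<^sup>2 + 8 * j + 1 = (3 * j + 10 * e) + (1 + 10 * j)"
    by (simp_all add: power2_eq_square algebra_simps)
  have "quint_coeff q (q ^ 10) j = (-1) powi j * (q powi (3 * j + 10 * e) * (1 + q powi (1 + 10 * j)))"
    using assms by (simp add: quint_coeff_def e_def[symmetric] power_int_power power_int_add)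
  then show ?thesis
    unfolding e using power_int_add[of q "3 * j + 10 * e" "1 + 10 * j"] assms
    by (simp only: distrib_left mult_1_right simp_thms)
qed

text \<open>The indices n = 0, 1 give j = 0. The next blocks 4N+2, ..., 4N+5 are where (n+2) div 4
  is constantly N + 1; their roots 15(N+1) - 4, -1, +1, +4 belong to j = -(N+1), N+1, -(N+1), N+1 in
  turn.\<close>

lemma sum_square_index_seq_eq:
  fixes q :: "'a::field"
  assumes "q \<noteq> 0"
  shows "(\<Sum>n<4 * N + 2. (-1) ^ ((n + 2) div 4) * q ^ square_index_seq n) =
    (\<Sum>j=-int N..int N. quint_coeff q (q ^ 10) j)"
  unfolding sum_symmetric_int
proof (induction N)
  case 0
  show ?case
    using square_index_seq_simps(1,2)[of 0]
    by (simp add: quint_coeff_def numeral_2_eq_2)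
next
  case (Suc N)
  let ?t = "\<lambda>n. (-1) ^ ((n + 2) div 4) * q ^ square_index_seq n"
  have split: "(\<Sum>n<4 * Suc N + 2. ?t n) =
     (\<Sum>n<4 * N + 2. ?t n) + (?t (4 * N + 2) + ?t (4 * N + 3) + ?t (4 * Suc N) + ?t (4 * Suc N + 1))"
  proof -
    have "4 * Suc N + 2 = Suc (Suc (Suc (Suc (4 * N + 2))))"
      by simp
    moreover have "4 * N + 3 = Suc (4 * N + 2)" "4 * Suc N = Suc (Suc (4 * N + 2))"
      "4 * Suc N + 1 = Suc (Suc (Suc (4 * N + 2)))"
      by simp_all
    ultimately show ?thesis
      by (simp only: sum.lessThan_Suc add.assoc)
  qed
  have d: "(4 * N + 2 + 2) div 4 = Suc N" "(4 * N + 3 + 2) div 4 = Suc N"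
    "(4 * Suc N + 2) div 4 = Suc N" "(4 * Suc N + 1 + 2) div 4 = Suc N"
    by simp_all
  have e: "15 * (int (Suc N))\<^sup>2 - 2 * int (Suc N) = int (15 * N\<^sup>2 + 28 * N + 13)"
    "15 * (int (Suc N))\<^sup>2 + 8 * int (Suc N) + 1 = int (15 * (Suc N)\<^sup>2 + 8 * Suc N + 1)"
    "15 * (- int (Suc N))\<^sup>2 - 2 * (- int (Suc N)) = int (15 * (Suc N)\<^sup>2 + 2 * Suc N)"
    "15 * (- int (Suc N))\<^sup>2 + 8 * (- int (Suc N)) + 1 = int (15 * N\<^sup>2 + 22 * N + 8)"
    by (simp_all add: power2_eq_square algebra_simps)
  have s: "(-1) powi (int (Suc N)) = (-1::'a) ^ Suc N" "(-1) powi (- int (Suc N)) = (-1::'a) ^ Suc N"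
    by (simp_all only: power_int_of_nat power_int_minus) (simp flip: power_inverse)
  have "quint_coeff q (q ^ 10) (int (Suc N)) + quint_coeff q (q ^ 10) (- int (Suc N)) =
     ?t (4 * N + 2) + ?t (4 * N + 3) + ?t (4 * Suc N) + ?t (4 * Suc N + 1)"
    unfolding quint_coeff_power_10[OF assms] e s power_int_of_nat d square_index_seq_simps
    by (simp only: distrib_left add_ac)
  then show ?case
    unfolding split Suc sum.lessThan_Suc by (simp only: add.assoc)
qed

lemma sums_of_block_limit:
  fixes f :: "nat \<Rightarrow> 'a::banach"
  assumes "summable (\<lambda>n. norm (f n))" "strict_mono g" "(\<lambda>N. \<Sum>n<g N. f n) \<longlonglongrightarrow> s"
  shows "f sums s"
proof -
  have f: "f sums suminf f"
    by (rule summable_sums[OF summable_norm_cancel[OF assms(1)]])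
  then have "(\<lambda>N. \<Sum>n<g N. f n) \<longlonglongrightarrow> suminf f"
    using LIMSEQ_subseq_LIMSEQ[OF _ assms(2)] by (fastforce simp: sums_def o_def)
  then show ?thesis
    using f assms(3) LIMSEQ_unique by blast
qed

theorem theorem11:
  fixes q :: complex
  assumes "norm q < 1"
  shows "(\<lambda>n. (-1) ^ ((n + 2) div 4) * q ^ enumerate square_index_set n) sums
    (qpochs_inf [q ^ 2, q ^ 6, q ^ 8] (q ^ 8) * qpochs_inf [q ^ 4, q ^ 12] (q ^ 16)
      / qpochs_inf [q, q ^ 4] (q ^ 5))"
proof (cases "q = 0")
  case True
  \<comment> \<open>For q = 0 only the exponent 0 contributes, and every product is 1. The quintuple
    product identity requires nonzero \<open>z\<close> and \<open>p\<close>, hence the separate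
    case.\<close>
  have zero: "square_index_seq n = 0 \<longleftrightarrow> n = 0" for n
    using strict_mono_eq[OF strict_mono_square_index_seq, of n 0] square_index_seq_simps(1)[of 0] by simp
  have "(\<lambda>n. (-1) ^ ((n + 2) div 4) * q ^ enumerate square_index_set n) = (\<lambda>n. if n = 0 then 1 else 0)"
    by (rule ext) (simp add: True enumerate_square_index_set power_0_left zero)
  moreover have "qpoch_inf 0 0 = 1"
    by (simp add: qpoch_inf_def)
  ultimately show ?thesis
    using sums_single[of 0 "\<lambda>_. 1::complex"] by (simp add: True qpochs_inf_def)
next
  case False
  have pow: "q ^ k \<noteq> 1" if "k > 0" for k
  proof -
    have "norm (q ^ k) < 1"
      using that assms by (simp add: norm_power power_less_one_iff)
    then show ?thesis
      by auto
  qed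
  have nz: "q\<^sup>2 * (q ^ 10) powi j \<noteq> 1" for j
  proof -
    have "q\<^sup>2 * (q ^ 10) powi j = q powi (2 + 10 * j)"
      using False by (simp add: power_int_add power_int_power)
    \<comment> \<open>The exponent 2 + 10j is never 0, and no power of q with nonzero integer
      exponent equals 1.\<close>
    also have "\<dots> \<noteq> 1"
    proof (cases "2 + 10 * j" rule: int_cases4)
      case (nonneg n)
      then have "n > 0"
        by presburger
      then show ?thesis
        using nonneg pow by simp
    next
      case (neg n)
      then show ?thesis
        using pow by (simp add: power_int_minus)
    qed
    finally show ?thesis .
  qed
  have "q ^ 10 / q\<^sup>2 = q ^ 8" "q ^ 10 / q = q ^ 9"
    using False by (simp_all add: field_simps flip: power_add power_Suc)
  with quintuple_product[OF _ _ False nz] assms False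
  have lim: "(\<lambda>n. \<Sum>j=-int n..int n. quint_coeff q (q ^ 10) j) \<longlonglongrightarrow>
    qpoch_inf (q ^ 10) (q ^ 10) * qpoch_inf (q ^ 2) (q ^ 10) * qpoch_inf (q ^ 8) (q ^ 10)
      / (qpoch_inf q (q ^ 10) * qpoch_inf (q ^ 9) (q ^ 10))"
    by (simp add: norm_power power_less_one_iff)
  show ?thesis
    unfolding theta_quotient_eq[OF assms] enumerate_square_index_set
  proof (rule sums_of_block_limit)
    \<comment> \<open>A strictly increasing sequence of naturals satisfies
      \<open>n \<le> square_index_seq n\<close>, so the geometric series dominates. Absolute
      convergence then upgrades the limit along the partial sums of length 4N + 2 to a limit of all
      partial sums.\<close>
    have "norm q ^ square_index_seq n \<le> norm q ^ n" for n
      using assms strict_mono_imp_increasing[OF strict_mono_square_index_seq, of n]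
      by (intro power_decreasing) auto
    then show "summable (\<lambda>n. norm ((-1) ^ ((n + 2) div 4) * q ^ square_index_seq n))"
      using assms by (intro summable_comparison_test'[OF summable_geometric[of "norm q"]])
        (simp_all add: norm_mult norm_power)
    show "strict_mono (\<lambda>N::nat. 4 * N + 2)"
      by (simp add: strict_mono_def)
    show "(\<lambda>N. \<Sum>n<4 * N + 2. (-1) ^ ((n + 2) div 4) * q ^ square_index_seq n) \<longlonglongrightarrow>
      qpoch_inf (q ^ 10) (q ^ 10) * qpoch_inf (q ^ 2) (q ^ 10) * qpoch_inf (q ^ 8) (q ^ 10)
      / (qpoch_inf q (q ^ 10) * qpoch_inf (q ^ 9) (q ^ 10))"
      unfolding sum_square_index_seq_eq[OF False] by (rule lim)
  qed
qed

end
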